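(* Let $\mathcal{P}$ be a common/innovation component joint sparsity model for $J$ signals of length $N$, and let $X\in\mathbb{R}^{JN}$ be a signal ensemble obtained from $\mathcal{P}$. Let $(M_1,\dots,M_J)$ be a tuple of numbers of measurements, let $\Phi_j$, $j\in\Lambda=\{1,\dots,J\}$, be random $M_j\times N$ matrices with i.i.d. Gaussian entries, let $\Phi=\mathrm{diag}(\Phi_1,\dots,\Phi_J)$ be the block-diagonal matrix, and write $Y=\Phi X$. Suppose there exists a full rank location matrix $P\in\mathcal{P}_F(X)$ such that $$\sum_{j\in\Gamma} M_j\ <\ K_{\mathrm{cond}}(\Gamma,P)\qquad\text{for some }\Gamma\subseteq\Lambda .$$ Then there exists a solution $\widehat\Theta$ such that $Y=\Phi P\widehat\Theta$ but $\widehat X:=P\widehat\Theta\ne X$.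
   Context: Signals $x_1,\dots,x_J\in\mathbb{R}^N$ are stacked as $X=[x_1^T\ \cdots\ x_J^T]^T\in\mathbb{R}^{JN}$; sensor $j$ observes $y_j=\Phi_jx_j$, and $Y=[y_1^T\ \cdots\ y_J^T]^T=\Phi X$. An identity submatrix is a matrix whose columns are distinct columns of the $N\times N$ identity matrix (possibly with no columns). A common/innovation component joint sparsity model is a set $\mathcal{P}$ of location matrices of the form $$P=\begin{bmatrix}P_C&P_1&0&\cdots&0\\P_C&0&P_2&\cdots&0\\ \vdots&\vdots&\vdots&\ddots&\vdots\\P_C&0&0&\cdots&P_J\end{bmatrix},$$ where $P_C$ ($N\times K_C(P)$) and $P_j$ ($N\times K_j(P)$), $j\in\Lambda$, are identity submatrices. It models $x_j=z_C+z_j$ with common component $z_C=P_C\theta_C$ and innovations $z_j=P_j\theta_j$. The ensemble $X$ is obtained from $\mathcal{P}$ if $X=P\Theta$ for some $P\in\mathcal{P}$ and some vector $\Theta$. $\mathcal{P}_F(X)\subseteq\mathcal{P}$ is the set of those $P\in\mathcal{P}$ for which there is a vector $\Theta=[\theta_C^T\ \theta_1^T\cdots\theta_J^T]^T$ with $X=P\Theta$. "Full rank" means full column rank. For $\Gamma\subseteq\Lambda$, the overlap size $K_C(\Gamma,P)$ is the number of indices $n\in\{1,\dots,N\}$ such that the $n$-th canonical unit vector is a column of $P_C$ and is a column of $P_j$ for every $j\notin\Gamma$; moreover $K_C(\Lambda,P)=K_C(P)$ and $K_C(\emptyset,P)=0$ by convention. The conditional sparsity is $K_{\mathrm{cond}}(\Gamma,P)=\big(\sum_{j\in\Gamma}K_j(P)\big)+K_C(\Gamma,P)$.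 *)

theory Defs
  imports "HOL-Probability.Probability" "Jordan_Normal_Form.DL_Rank"
begin

text \<open>Vectors and matrices are the dimension-carrying \<^typ>\<open>real vec\<close> and \<^typ>\<open>real mat\<close> of
  Jordan_Normal_Form, because the number of columns of a location matrix varies within a model.
  The Cartesian product types of HOL-Analysis with the same names are hidden.\<close>

hide_type (open) Finite_Cartesian_Product.vec
hide_const (open) Finite_Cartesian_Product.vec Finite_Cartesian_Product.mat
  Finite_Cartesian_Product.row Finite_Cartesian_Product.column
no_notation Finite_Cartesian_Product.vec_nth (infixl \<open>$\<close> 90)

definition identity_submatrix :: "nat \<Rightarrow> real mat \<Rightarrow> bool" where
  "identity_submatrix N A \<longleftrightarrow>
     dim_row A = N \<and> distinct (cols A) \<and> set (cols A) \<subseteq> set (cols (1\<^sub>m N))"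

text \<open>The block structure cannot be recovered from the assembled matrix (for one signal,
  \<open>[P_C P_1]\<close> can be cut at any column), whereas the sparsities depend on it. A location matrix
  is therefore given by its blocks: \<open>P_C\<close>, and the list \<open>P_1, ..., P_J\<close>. Sensors are numbered
  from 0, so that the sensor set is \<open>{..<J}\<close>.\<close>

datatype location = Location (common: "real mat") (innovs: "real mat list")

definition is_location :: "nat \<Rightarrow> nat \<Rightarrow> location \<Rightarrow> bool" where
  "is_location N J P \<longleftrightarrow>
     identity_submatrix N (common P) \<and> length (innovs P) = J \<and>
     (\<forall>A \<in> set (innovs P). identity_submatrix N A)"

text \<open>The common block is \<open>P_C\<close> stacked vertically, once for each sensor; to its right stands
  the block-diagonal matrix of the innovation blocks.\<close>

definition location_matrix :: "location \<Rightarrow> real mat" where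
  "location_matrix P =
     (let J = length (innovs P);
          C = mat_of_rows (dim_col (common P)) (concat (replicate J (rows (common P))));
          D = diag_block_mat (innovs P)
      in mat_of_cols (dim_row C) (cols C @ cols D))"

definition joint_sparsity_model :: "nat \<Rightarrow> nat \<Rightarrow> location set \<Rightarrow> bool" where
  "joint_sparsity_model N J \<P> \<longleftrightarrow> (\<forall>P \<in> \<P>. is_location N J P)"

definition feasible_locations :: "location set \<Rightarrow> real vec \<Rightarrow> location set" where
  "feasible_locations \<P> X =
     {P \<in> \<P>. \<exists>\<Theta> \<in> carrier_vec (dim_col (location_matrix P)). X = location_matrix P *\<^sub>v \<Theta>}"

definition obtained_from :: "real vec \<Rightarrow> location set \<Rightarrow> bool" where
  "obtained_from X \<P> \<longleftrightarrow>
     (\<exists>P \<in> \<P>. \<exists>\<Theta> \<in> carrier_vec (dim_col (location_matrix P)). X = location_matrix P *\<^sub>v \<Theta>)"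

definition full_column_rank :: "real mat \<Rightarrow> bool" where
  "full_column_rank A \<longleftrightarrow> vec_space.rank (dim_row A) A = dim_col A"

definition K_C :: "location \<Rightarrow> nat" where
  "K_C P = dim_col (common P)"

definition K_innov :: "location \<Rightarrow> nat \<Rightarrow> nat" where
  "K_innov P j = dim_col (innovs P ! j)"

definition overlap_size :: "nat set \<Rightarrow> location \<Rightarrow> nat" where
  "overlap_size \<Gamma> P =
     (let N = dim_row (common P); \<Lambda> = {..<length (innovs P)} in
      if \<Gamma> = {} then 0
      else if \<Gamma> = \<Lambda> then K_C P
      else card {n. n < N \<and> unit_vec N n \<in> set (cols (common P)) \<and>
                    (\<forall>j \<in> \<Lambda> - \<Gamma>. unit_vec N n \<in> set (cols (innovs P ! j)))})"

definition K_cond :: "nat set \<Rightarrow> location \<Rightarrow> nat" where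
  "K_cond \<Gamma> P = (\<Sum>j\<in>\<Gamma>. K_innov P j) + overlap_size \<Gamma> P"

text \<open>Common mean and variance are arbitrary, but the distribution is not degenerate.\<close>

definition iid_gaussian_matrix :: "'w measure \<Rightarrow> nat \<Rightarrow> nat \<Rightarrow> ('w \<Rightarrow> real mat) \<Rightarrow> bool" where
  "iid_gaussian_matrix W m n A \<longleftrightarrow>
     (\<forall>\<omega> \<in> space W. A \<omega> \<in> carrier_mat m n) \<and>
     prob_space.indep_vars W (\<lambda>_. borel) (\<lambda>(i, k) \<omega>. A \<omega> $$ (i, k)) ({..<m} \<times> {..<n}) \<and>
     (\<exists>\<mu> \<sigma>. \<sigma> > 0 \<and> (\<forall>i<m. \<forall>k<n.
        distributed W lborel (\<lambda>\<omega>. A \<omega> $$ (i, k)) (\<lambda>x. ennreal (normal_density \<mu> \<sigma> x))))"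

definition measurement_matrix :: "nat \<Rightarrow> (nat \<Rightarrow> 'w \<Rightarrow> real mat) \<Rightarrow> 'w \<Rightarrow> real mat" where
  "measurement_matrix J \<Phi> \<omega> = diag_block_mat (map (\<lambda>j. \<Phi> j \<omega>) [0..<J])"

end

(* Put L = location_matrix P. Since L has full column rank, it suffices to find a nonzero vector v
   with Phi L v = 0. Require that L v vanishes outside the sensors in Gamma, and that Phi L v = 0 on
   the sensors in Gamma. The first requirement follows from K - K_cond linear equations, where K is
   the number of columns of L: the common coordinates outside the overlap are 0, and for each
   sensor j outside Gamma the signal vanishes on the support of P_j (on the overlap, the
   innovation then cancels the common component). The second is sum_{j in Gamma} M_j equations.
   Together these are fewer than K equations in K unknowns. *)

theory Submission
  imports Defs
begin

section \<open>Linear algebra: homogeneous systems and column rank\<close>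

text \<open>Fewer equations than unknowns: padding the vectors of \<open>S\<close> with zero rows
  gives a square singular matrix, and any nonzero kernel vector of it serves.\<close>

lemma exists_nonzero_orthogonal_vec:
  fixes S :: "'a::field vec set"
  assumes "finite S" and S: "S \<subseteq> carrier_vec n" and "card S < n"
  shows "\<exists>v \<in> carrier_vec n. v \<noteq> 0\<^sub>v n \<and> (\<forall>a\<in>S. scalar_prod a v = 0)"
proof -
  obtain as where as: "set as = S" "distinct as"
    using finite_distinct_list[OF \<open>finite S\<close>] by blast
  then have len: "length as < n"
    using \<open>card S < n\<close> distinct_card by fastforce
  define c where "c i = (if i < length as then as ! i else 0\<^sub>v n)" for i
  \<comment> \<open>\<open>c\<close> is already zero at \<open>length as\<close>; the explicit case
    distinction gives the matrix the shape that \<open>det_row_0\<close> expects. This row exists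
    because \<open>length as < n\<close>.\<close>
  define A where "A = mat\<^sub>r n n (\<lambda>i. if i = length as then 0\<^sub>v n else c i)"
  have A: "A \<in> carrier_mat n n"
    by (simp add: A_def)
  have c: "c i \<in> carrier_vec n" for i
    using S as by (auto simp: c_def)
  have "det A = 0"
    unfolding A_def using c by (intro det_row_0[OF len]) auto
  then obtain v where v: "v \<in> carrier_vec n" "v \<noteq> 0\<^sub>v n" "A *\<^sub>v v = 0\<^sub>v n"
    using A det_0_iff_vec_prod_zero_field by blast
  have "scalar_prod a v = 0" if "a \<in> S" for a
  proof -
    obtain i where i: "i < length as" "as ! i = a"
      using \<open>a \<in> S\<close> as by (metis in_set_conv_nth)
    then have "row A i = a"
      using c[of i] len by (simp add: A_def c_def)
    moreover have "(A *\<^sub>v v) $ i = 0"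
      using v i len by simp
    ultimately show ?thesis
      using A i len by simp
  qed
  with v show ?thesis by blast
qed

text \<open>A nonzero kernel vector would be a linear dependence among the columns. Independence
  concerns the set of columns, so repetitions are excluded first: they would leave fewer than
  \<open>dim_col A\<close> vectors, too few for the rank.\<close>

lemma full_column_rank_mult_nonzero:
  assumes "full_column_rank A" and v: "v \<in> carrier_vec (dim_col A)" "v \<noteq> 0\<^sub>v (dim_col A)"
  shows "A *\<^sub>v v \<noteq> 0\<^sub>v (dim_row A)"
proof
  assume Av: "A *\<^sub>v v = 0\<^sub>v (dim_row A)"
  interpret vec_space "TYPE(real)" "dim_row A" .
  have A: "A \<in> carrier_mat (dim_row A) (dim_col A)" by simp
  have rank: "rank A = dim_col A"
    using assms(1) by (simp add: full_column_rank_def)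
  have "distinct (cols A)"
  proof (rule ccontr)
    assume "\<not> distinct (cols A)"
    obtain S where S: "maximal S (\<lambda>T. T \<subseteq> set (cols A) \<and> lin_indpt T)"
      using maximal_exists[of "(\<lambda>T. T \<subseteq> set (cols A) \<and> lin_indpt T)" "card (set (cols A))" "{}"]
      by (meson List.finite_set card_mono empty_iff empty_subsetI finite_lin_indpt2 rev_finite_subset)
    then have "rank A \<le> card (set (cols A))"
      using rank_card_indpt[OF A S] by (simp add: card_mono maximal_def)
    also have "\<dots> < dim_col A"
      using \<open>\<not> distinct (cols A)\<close> card_distinct card_length
      by (metis cols_length nat_less_le)
    finally show False using rank by simp
  qed
  then show False
    using full_rank_lin_indpt[OF A rank] lin_depI[OF A v Av] by blast
qed

section \<open>Rows of block-diagonal matrices\<close>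

lemma diag_block_mat_row_cases:
  assumes "i < dim_row (diag_block_mat As)"
  obtains j r where "j < length As" and "r < dim_row (As ! j)"
    and "i = sum_list (map dim_row (take j As)) + r"
  using assms
proof (induction As arbitrary: i thesis)
  case (Cons A As)
  show ?case
  proof (cases "i < dim_row A")
    case True
    then show ?thesis using Cons.prems(1)[of 0 i] by simp
  next
    case False
    then have "i - dim_row A < dim_row (diag_block_mat As)"
      using Cons.prems(2) by (simp add: Let_def)
    from Cons.IH[OF _ this] obtain j r where "j < length As" "r < dim_row (As ! j)"
      "i - dim_row A = sum_list (map dim_row (take j As)) + r" by blast
    then show ?thesis using False by (intro Cons.prems(1)[of "Suc j" r]) auto
  qed
qed simp

lemma diag_block_mat_row_less:
  assumes "j < length As" and "r < dim_row (As ! j)"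
  shows "sum_list (map dim_row (take j As)) + r < dim_row (diag_block_mat As)"
  using assms
proof (induction As arbitrary: j)
  case (Cons A As)
  then show ?case by (cases j) (auto simp: Let_def)
qed simp

text \<open>The induction peels off the top left block. For a later block, columns left of
  \<open>dim_col A\<close> meet a zero block, and all others shift to the tail.\<close>

lemma diag_block_mat_index:
  assumes "j < length As" and "r < dim_row (As ! j)" and "c < dim_col (diag_block_mat As)"
  shows "diag_block_mat As $$ (sum_list (map dim_row (take j As)) + r, c) =
    (let d = sum_list (map dim_col (take j As))
     in if d \<le> c \<and> c < d + dim_col (As ! j) then As ! j $$ (r, c - d) else 0)"
  using assms
proof (induction As arbitrary: j c)
  case (Cons A As)
  show ?case
  proof (cases j)
    case 0
    then show ?thesis using Cons.prems by (auto simp: Let_def)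
  next
    case (Suc k)
    have k: "k < length As" "r < dim_row (As ! k)" using Cons.prems Suc by auto
    note less = diag_block_mat_row_less[OF k]
    show ?thesis
    proof (cases "c < dim_col A")
      case True
      then show ?thesis using less Suc Cons.prems by (auto simp: Let_def)
    next
      case False
      then have c: "c - dim_col A < dim_col (diag_block_mat As)"
        using Cons.prems by (auto simp: Let_def)
      show ?thesis
        using Cons.IH[OF k c] False less Suc Cons.prems
        by (auto simp: Let_def)
    qed
  qed
qed simp

lemma diag_block_mat_mult_vec_zero:
  fixes v :: "'a::semiring_0 vec"
  assumes "j < length As" and "r < dim_row (As ! j)" and v: "v \<in> carrier_vec (dim_col (diag_block_mat As))"
    and zero: "\<And>s. s < dim_col (As ! j) \<Longrightarrow> v $ (sum_list (map dim_col (take j As)) + s) = 0"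
  shows "(diag_block_mat As *\<^sub>v v) $ (sum_list (map dim_row (take j As)) + r) = 0"
proof -
  let ?D = "diag_block_mat As" and ?i = "sum_list (map dim_row (take j As)) + r"
    and ?d = "sum_list (map dim_col (take j As))"
  have i: "?i < dim_row ?D"
    using assms by (intro diag_block_mat_row_less)
  \<comment> \<open>Within the column range of block \<open>j\<close> the factor from
    \<open>v\<close> vanishes, outside it the factor from the matrix.\<close>
  have "?D $$ (?i, c) * v $ c = 0" if "c < dim_col ?D" for c
    using zero[of "c - ?d"] diag_block_mat_index[OF assms(1,2) that]
    by (auto simp: Let_def)
  then show ?thesis
    using i v by (simp add: scalar_prod_def)
qed

section \<open>Indices in stacks of blocks of equal height\<close>

lemma mult_add_less_mult:
  fixes j J n N :: nat
  assumes "j < J" and "n < N"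
  shows "j * N + n < J * N"
proof -
  have "j * N + n < Suc j * N" using assms by simp
  also have "\<dots> \<le> J * N" using assms by (intro mult_le_mono1) simp
  finally show ?thesis .
qed

lemma concat_replicate_nth:
  assumes "j < J" and "n < length xs"
  shows "concat (replicate J xs) ! (j * length xs + n) = xs ! n"
  using assms
proof (induction J arbitrary: j)
  case (Suc J)
  then show ?case by (cases j) (auto simp: nth_append)
qed simp

lemma sum_list_map_take_const:
  assumes "\<And>x. x \<in> set xs \<Longrightarrow> f x = c" and "j \<le> length xs"
  shows "sum_list (map f (take j xs)) = j * (c :: nat)"
proof -
  have "map f (take j xs) = replicate j c"
    using assms by (intro nth_equalityI) auto
  then show ?thesis by (simp add: sum_list_replicate)
qed

section \<open>Overlaps and entries of location matrices\<close>

text \<open>Passes from counting positions to counting columns of the common block, which index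
  coordinates of \<Theta>: distinct positions give distinct unit vectors, hence different
  columns.\<close>

lemma overlap_size_le:
  assumes "is_location N J P" and "\<Gamma> \<subseteq> {..<J}"
  shows "overlap_size \<Gamma> P \<le> card {k. k < K_C P \<and>
    (\<forall>j \<in> {..<J} - \<Gamma>. col (common P) k \<in> set (cols (innovs P ! j)))}" (is "_ \<le> card ?G")
proof -
  have J: "length (innovs P) = J" using assms by (simp add: is_location_def)
  let ?O = "{n. n < dim_row (common P) \<and> unit_vec (dim_row (common P)) n \<in> set (cols (common P)) \<and>
    (\<forall>j \<in> {..<J} - \<Gamma>. unit_vec (dim_row (common P)) n \<in> set (cols (innovs P ! j)))}"
  have fin: "finite ?G" by simp
  have "card ?O = card (unit_vec (dim_row (common P)) ` ?O :: real vec set)"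
    by (rule card_image[symmetric]) (auto simp: inj_on_def unit_vec_eq)
  also have "\<dots> \<le> card (col (common P) ` ?G)"
  proof (rule card_mono)
    show "unit_vec (dim_row (common P)) ` ?O \<subseteq> col (common P) ` ?G"
    proof
      fix x :: "real vec" assume "x \<in> unit_vec (dim_row (common P)) ` ?O"
      then obtain n where x: "x = unit_vec (dim_row (common P)) n" "n \<in> ?O" by blast
      then have "x \<in> set (cols (common P))" by blast
      then obtain k where "k < dim_col (common P)" "x = col (common P) k"
        by (metis cols_length cols_nth in_set_conv_nth)
      with x have "k \<in> ?G" by (simp add: K_C_def)
      with \<open>x = col (common P) k\<close> show "x \<in> col (common P) ` ?G" by (rule image_eqI)
    qed
  qed simp
  also have "\<dots> \<le> card ?G"
    by (rule card_image_le[OF fin])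
  finally show ?thesis
    \<comment> \<open>The conventional values also fit: 0 is trivially a lower bound, and for the
      full sensor set the condition on \<open>k\<close> is vacuous, so all \<open>K_C P\<close>
      columns are counted.\<close>
    by (auto simp: overlap_size_def Let_def J)
qed

lemma identity_submatrix_col:
  assumes "identity_submatrix N A" and "n < N" and "k < dim_col A" and "A $$ (n, k) \<noteq> 0"
  shows "col A k = unit_vec N n"
proof -
  have "col A k \<in> set (cols (1\<^sub>m N))"
    using assms by (metis cols_length cols_nth identity_submatrix_def nth_mem subsetD)
  then obtain m where "m < N" "col A k = unit_vec N m"
    by (auto simp: cols_def)
  moreover have "col A k $ n \<noteq> 0"
    using assms by (simp add: identity_submatrix_def)
  ultimately show ?thesis
    using \<open>n < N\<close> by (cases "m = n") auto
qed

lemma location_matrix_carrier: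
  assumes "is_location N J P"
  shows "location_matrix P \<in> carrier_mat (J * N) (K_C P + (\<Sum>j<J. K_innov P j))"
proof -
  have len: "length (concat (replicate J (rows (common P)))) = J * N"
    using assms by (simp add: is_location_def identity_submatrix_def length_concat sum_list_replicate)
  have "sum_list (map dim_col (innovs P)) = (\<Sum>j<J. K_innov P j)"
    using assms by (simp add: is_location_def K_innov_def sum_list_sum_nth atLeast0LessThan)
  with len show ?thesis
    using assms by (intro carrier_matI) (simp_all add: location_matrix_def Let_def is_location_def K_C_def dim_diag_block_mat)
qed

text \<open>All blocks have \<open>N\<close> rows, so sensor \<open>j\<close> starts at row
  \<open>j * N\<close> both in the stacked copies of the common block and in the block-diagonal
  part. The widths vary, so the column offset remains a sum.\<close>

lemma location_matrix_index:
  assumes P: "is_location N J P" and j: "j < J" and n: "n < N"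
    and c: "c < dim_col (location_matrix P)"
  shows "location_matrix P $$ (j * N + n, c) =
    (let d = K_C P + sum_list (map dim_col (take j (innovs P)))
     in if c < K_C P then common P $$ (n, c)
        else if d \<le> c \<and> c < d + K_innov P j then innovs P ! j $$ (n, c - d) else 0)"
proof -
  let ?D = "diag_block_mat (innovs P)"
  let ?R = "concat (replicate J (rows (common P)))"
  have J: "length (innovs P) = J" and N: "length (rows (common P)) = N" "dim_row (common P) = N"
    and inn: "\<And>A. A \<in> set (innovs P) \<Longrightarrow> dim_row A = N"
    using P by (auto simp: is_location_def identity_submatrix_def)
  have len: "length ?R = J * N"
    by (simp add: N length_concat sum_list_replicate)
  have offset: "sum_list (map dim_row (take j (innovs P))) = j * N"
    using inn j J by (intro sum_list_map_take_const) auto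
  have i: "j * N + n < J * N"
    using mult_add_less_mult[OF j n] .
  have D: "dim_row ?D = J * N"
    using sum_list_map_take_const[of "innovs P" dim_row N J] inn J by (simp add: dim_diag_block_mat)
  have dim: "dim_col (location_matrix P) = K_C P + dim_col ?D"
    by (simp add: location_matrix_def Let_def K_C_def)
  show ?thesis
  proof (cases "c < K_C P")
    case True
    then have "location_matrix P $$ (j * N + n, c) = ?R ! (j * N + n) $ c"
      using i len by (simp add: location_matrix_def Let_def K_C_def J mat_of_cols_index nth_append mat_of_rows_index)
    also have "\<dots> = common P $$ (n, c)"
      using concat_replicate_nth[OF j, of n "rows (common P)"] N n True by (simp add: K_C_def)
    finally show ?thesis using True by (simp add: Let_def)
  next
    case False
    then have c': "c - K_C P < dim_col ?D" using c dim by linarith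
    with False have "location_matrix P $$ (j * N + n, c) = ?D $$ (j * N + n, c - K_C P)"
      using i len D by (simp add: location_matrix_def Let_def K_C_def J mat_of_cols_index nth_append)
    also have "\<dots> = (let d = sum_list (map dim_col (take j (innovs P)))
       in if d \<le> c - K_C P \<and> c - K_C P < d + dim_col (innovs P ! j)
          then innovs P ! j $$ (n, c - K_C P - d) else 0)"
      using diag_block_mat_index[of j "innovs P" n "c - K_C P"] j J n inn c' offset by simp
    finally show ?thesis using False by (auto simp: Let_def K_innov_def)
  qed
qed

text \<open>Off the support of its innovation, sensor \<open>j\<close> sees only the common
  component, and there only a column equal to the unit vector at \<open>n\<close>
  contributes.\<close>

lemma location_matrix_mult_vec_zero:
  assumes P: "is_location N J P" and j: "j < J" and n: "n < N"
    and v: "v \<in> carrier_vec (dim_col (location_matrix P))"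
    and innov: "unit_vec N n \<notin> set (cols (innovs P ! j))"
    and common: "\<And>k. k < K_C P \<Longrightarrow> col (common P) k = unit_vec N n \<Longrightarrow> v $ k = 0"
  shows "(location_matrix P *\<^sub>v v) $ (j * N + n) = 0"
proof -
  have i: "j * N + n < dim_row (location_matrix P)"
    using mult_add_less_mult[OF j n] location_matrix_carrier[OF P] by simp
  have idC: "identity_submatrix N (common P)" and idI: "identity_submatrix N (innovs P ! j)"
    using P j by (auto simp: is_location_def)
  have 1: "common P $$ (n, c) = 0 \<or> v $ c = 0" if "c < K_C P" for c
    using identity_submatrix_col[OF idC n] common that by (auto simp: K_C_def)
  have 2: "innovs P ! j $$ (n, s) = 0" if "s < K_innov P j" for s
    using identity_submatrix_col[OF idI n, of s] innov that unfolding K_innov_def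
    by (metis cols_length cols_nth nth_mem)
  have "location_matrix P $$ (j * N + n, c) * v $ c = 0" if "c < dim_col (location_matrix P)" for c
    using location_matrix_index[OF P j n that] 1[of c]
      2[of "c - (K_C P + sum_list (map dim_col (take j (innovs P))))"]
    by (auto simp: Let_def)
  then show ?thesis
    using i v by (simp add: scalar_prod_def sum.neutral del: mult_eq_0_iff)
qed

section \<open>Construction of the second solution\<close>

theorem theorem5:
  fixes W :: "'w measure"
    and N J :: nat
    and \<P> :: "location set"
    and X :: "real vec"
    and M :: "nat \<Rightarrow> nat"
    and \<Phi> :: "nat \<Rightarrow> 'w \<Rightarrow> real mat"
    and P :: location
    and \<Gamma> :: "nat set"
  assumes "joint_sparsity_model N J \<P>"
    and "X \<in> carrier_vec (J * N)"
    and "obtained_from X \<P>"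
    and "prob_space W"
    and "\<And>j. j < J \<Longrightarrow> iid_gaussian_matrix W (M j) N (\<Phi> j)"
    and "P \<in> feasible_locations \<P> X"
    and "full_column_rank (location_matrix P)"
    and "\<Gamma> \<subseteq> {..<J}"
    and "(\<Sum>j\<in>\<Gamma>. M j) < K_cond \<Gamma> P"
  shows "\<forall>\<omega> \<in> space W.
    \<exists>\<Theta> \<in> carrier_vec (dim_col (location_matrix P)).
      measurement_matrix J \<Phi> \<omega> *\<^sub>v X
        = (measurement_matrix J \<Phi> \<omega> * location_matrix P) *\<^sub>v \<Theta> \<and>
      location_matrix P *\<^sub>v \<Theta> \<noteq> X"
proof
  fix \<omega> assume \<omega>: "\<omega> \<in> space W"
  define L where "L = location_matrix P"
  define As where "As = map (\<lambda>j. \<Phi> j \<omega>) [0..<J]"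
  define F where "F = diag_block_mat As"
  define K where "K = K_C P + (\<Sum>j<J. K_innov P j)"
  \<comment> \<open>\<open>off j\<close> is the first row of sensor \<open>j\<close> in
    \<open>F\<close>. The blocks have varying heights \<open>M j\<close> but common width
    \<open>N\<close>, so the matching column offset is \<open>j * N\<close>.\<close>
  define off where "off j = sum_list (map dim_row (take j As))" for j
  have P: "is_location N J P"
    using assms(1,6) by (auto simp: joint_sparsity_model_def feasible_locations_def)
  have L: "L \<in> carrier_mat (J * N) K"
    unfolding L_def K_def by (rule location_matrix_carrier[OF P])
  have len: "length As = J" and As: "\<And>j. j < J \<Longrightarrow> As ! j \<in> carrier_mat (M j) N"
    using assms(5) \<omega> by (auto simp: As_def iid_gaussian_matrix_def)
  have As_col: "\<And>A. A \<in> set As \<Longrightarrow> dim_col A = N"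
    using len As by (metis carrier_matD(2) in_set_conv_nth)
  have off_col: "sum_list (map dim_col (take j As)) = j * N" if "j \<le> J" for j
    using As_col that len by (intro sum_list_map_take_const) auto
  have F: "F \<in> carrier_mat (dim_row F) (J * N)"
    using off_col[of J] len by (auto simp: F_def dim_diag_block_mat)

  \<comment> \<open>The overlap, expressed by columns of the common block.\<close>
  define G where "G = {k. k < K_C P \<and>
    (\<forall>j \<in> {..<J} - \<Gamma>. col (common P) k \<in> set (cols (innovs P ! j)))}"
  define R where "R j = {n. n < N \<and> unit_vec N n \<in> set (cols (innovs P ! j))}" for j
  \<comment> \<open>Each vector \<open>a\<close> in these sets encodes the equation
    \<open>scalar_prod a v = 0\<close>. \<open>S\<^sub>C\<close> annihilates the common coordinates
    outside \<open>G\<close>; \<open>S\<^sub>I\<close> annihilates the signals of sensors outside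
    \<Gamma> on their innovation supports; \<open>S\<^sub>M\<close> annihilates the measurements of
    sensors in \<Gamma>.\<close>
  define S\<^sub>C where "S\<^sub>C = (unit_vec K ` ({..<K_C P} - G) :: real vec set)"
  define S\<^sub>I where "S\<^sub>I = (\<Union>j\<in>{..<J} - \<Gamma>. (\<lambda>n. row L (j * N + n)) ` R j)"
  define S\<^sub>M where "S\<^sub>M = (\<Union>j\<in>\<Gamma>. (\<lambda>r. row (F * L) (off j + r)) ` {..<M j})"
  have fin\<Gamma>: "finite \<Gamma>" using assms(8) finite_subset by blast
  have finR: "finite (R j)" for j by (simp add: R_def)
  have finS: "finite (S\<^sub>C \<union> S\<^sub>I \<union> S\<^sub>M)"
    using fin\<Gamma> finR by (auto simp: S\<^sub>C_def S\<^sub>I_def S\<^sub>M_def)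

  have "card (S\<^sub>C \<union> S\<^sub>I \<union> S\<^sub>M) \<le> card S\<^sub>C + card S\<^sub>I + card S\<^sub>M"
    by (meson add_le_mono1 card_Un_le le_trans)
  also have "\<dots> < K"
  proof -
    have "G \<subseteq> {..<K_C P}" by (auto simp: G_def)
    have "card S\<^sub>C \<le> card ({..<K_C P} - G)"
      unfolding S\<^sub>C_def by (rule card_image_le) simp
    also have "\<dots> = K_C P - card G"
      using \<open>G \<subseteq> {..<K_C P}\<close> by (simp add: card_Diff_subset finite_subset)
    \<comment> \<open>The additive form avoids truncated subtraction, so that the overlap cancels
      against the one in \<open>K_cond\<close> when the three bounds are added.\<close>
    finally have C: "card S\<^sub>C + overlap_size \<Gamma> P \<le> K_C P"
      using overlap_size_le[OF P assms(8)] card_mono[OF _ \<open>G \<subseteq> {..<K_C P}\<close>]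
      unfolding G_def[symmetric] by simp
    have R: "card (R j) \<le> K_innov P j" for j
    proof -
      have "card (R j) = card (unit_vec N ` R j :: real vec set)"
        by (rule card_image[symmetric]) (auto simp: inj_on_def R_def unit_vec_eq)
      also have "\<dots> \<le> card (set (cols (innovs P ! j)))"
        by (rule card_mono) (auto simp: R_def)
      also have "\<dots> \<le> K_innov P j"
        using card_length[of "cols (innovs P ! j)"] by (simp add: K_innov_def)
      finally show ?thesis .
    qed
    have "card S\<^sub>I \<le> (\<Sum>j\<in>{..<J} - \<Gamma>. card ((\<lambda>n. row L (j * N + n)) ` R j))"
      unfolding S\<^sub>I_def by (rule card_UN_le) simp
    also have "\<dots> \<le> (\<Sum>j\<in>{..<J} - \<Gamma>. K_innov P j)"
      by (intro sum_mono le_trans[OF card_image_le[OF finR] R])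
    finally have I: "card S\<^sub>I \<le> (\<Sum>j\<in>{..<J} - \<Gamma>. K_innov P j)" .
    have "card S\<^sub>M \<le> (\<Sum>j\<in>\<Gamma>. card ((\<lambda>r. row (F * L) (off j + r)) ` {..<M j}))"
      unfolding S\<^sub>M_def by (rule card_UN_le[OF fin\<Gamma>])
    also have "\<dots> \<le> (\<Sum>j\<in>\<Gamma>. M j)"
      by (intro sum_mono le_trans[OF card_image_le]) simp_all
    finally have M: "card S\<^sub>M < K_cond \<Gamma> P" using assms(9) by simp
    have "(\<Sum>j<J. K_innov P j) = (\<Sum>j\<in>{..<J} - \<Gamma>. K_innov P j) + (\<Sum>j\<in>\<Gamma>. K_innov P j)"
      using assms(8) by (simp add: sum.subset_diff)
    with C I M show ?thesis by (simp add: K_def K_cond_def)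
  qed
  finally have cardS: "card (S\<^sub>C \<union> S\<^sub>I \<union> S\<^sub>M) < K" .
  have "S\<^sub>C \<union> S\<^sub>I \<union> S\<^sub>M \<subseteq> carrier_vec K"
    using L by (auto intro!: carrier_vecI simp: S\<^sub>C_def S\<^sub>I_def S\<^sub>M_def)
  from exists_nonzero_orthogonal_vec[OF finS this cardS] obtain v where
    v: "v \<in> carrier_vec K" "v \<noteq> 0\<^sub>v K" and orth: "\<And>a. a \<in> S\<^sub>C \<union> S\<^sub>I \<union> S\<^sub>M \<Longrightarrow> scalar_prod a v = 0"
    by blast

  \<comment> \<open>On the innovation support this is an equation of \<open>S\<^sub>I\<close>.
    Elsewhere, a common column equal to the unit vector at \<open>n\<close> is missing from sensor
    \<open>j\<close>, hence lies outside \<open>G\<close>, and \<open>S\<^sub>C\<close> makes its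
    coordinate zero.\<close>
  have Lv: "(L *\<^sub>v v) $ (j * N + n) = 0" if j: "j < J" "j \<notin> \<Gamma>" and n: "n < N" for j n
  proof (cases "n \<in> R j")
    case True
    then have "row L (j * N + n) \<in> S\<^sub>I" using j by (auto simp: S\<^sub>I_def)
    moreover have "j * N + n < J * N"
      using mult_add_less_mult[OF j(1) n] .
    ultimately show ?thesis using orth L by simp
  next
    case False
    show ?thesis unfolding L_def
    proof (rule location_matrix_mult_vec_zero[OF P j(1) n])
      show "v \<in> carrier_vec (dim_col (location_matrix P))"
        using v L by (simp add: L_def)
      show nin: "unit_vec N n \<notin> set (cols (innovs P ! j))"
        using False n by (simp add: R_def)
      fix k assume k: "k < K_C P" "col (common P) k = unit_vec N n"
      then have "unit_vec K k \<in> S\<^sub>C"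
        using nin j by (auto simp: S\<^sub>C_def G_def)
      then have "scalar_prod (unit_vec K k) v = 0" using orth by blast
      then show "v $ k = 0" using k v by (simp add: K_def scalar_prod_left_unit)
    qed
  qed
  have FLv: "F *\<^sub>v (L *\<^sub>v v) = 0\<^sub>v (dim_row F)"
  proof (rule eq_vecI)
    fix i assume "i < dim_vec (0\<^sub>v (dim_row F) :: real vec)"
    then have i: "i < dim_row F" by simp
    then obtain j r where j: "j < J" and r: "r < dim_row (As ! j)" and ir: "i = off j + r"
      unfolding F_def off_def using diag_block_mat_row_cases len by metis
    \<comment> \<open>Sensors in \<Gamma> are handled by \<open>S\<^sub>M\<close>; for the others
      the signal itself is zero, whatever the entries of the measurement block.\<close>
    have "(F *\<^sub>v (L *\<^sub>v v)) $ i = 0"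
    proof (cases "j \<in> \<Gamma>")
      case True
      then have "row (F * L) i \<in> S\<^sub>M"
        using r ir As[OF j] by (auto simp: S\<^sub>M_def)
      then have "((F * L) *\<^sub>v v) $ i = 0"
        using orth i by simp
      then show ?thesis
        using assoc_mult_mat_vec[OF F L v(1)] by simp
    next
      case False
      have "L *\<^sub>v v \<in> carrier_vec (dim_col (diag_block_mat As))"
        using F mult_mat_vec_carrier[OF L v(1)] by (simp add: F_def[symmetric])
      moreover have "(L *\<^sub>v v) $ (sum_list (map dim_col (take j As)) + s) = 0"
        if "s < dim_col (As ! j)" for s
        using Lv[OF j False] that As[OF j] off_col[of j] j by simp
      ultimately show ?thesis unfolding F_def ir off_def
        using j r len by (intro diag_block_mat_mult_vec_zero) simp_all
    qed
    then show "(F *\<^sub>v (L *\<^sub>v v)) $ i = 0\<^sub>v (dim_row F) $ i" using i by simp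
  qed simp
  \<comment> \<open>Full rank ensures that \<open>v\<close> changes the ensemble and not merely its
    representation.\<close>
  have "L *\<^sub>v v \<noteq> 0\<^sub>v (J * N)"
    using full_column_rank_mult_nonzero[OF assms(7)] v L by (auto simp: L_def)
  obtain \<Theta> where \<Theta>: "\<Theta> \<in> carrier_vec K" "X = L *\<^sub>v \<Theta>"
    using assms(6) L by (auto simp: feasible_locations_def L_def)
  \<comment> \<open>The second solution is \<open>\<Theta> + v\<close>: the change of the ensemble
    is nonzero but invisible to \<open>F\<close>.\<close>
  have sum: "L *\<^sub>v (\<Theta> + v) = X + L *\<^sub>v v"
    using \<Theta> v L by (simp add: mult_add_distrib_mat_vec)
  have "(F * L) *\<^sub>v (\<Theta> + v) = F *\<^sub>v X + F *\<^sub>v (L *\<^sub>v v)"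
    using \<Theta> v assoc_mult_mat_vec[OF F L, of "\<Theta> + v"] sum L assms(2)
    by (simp add: mult_add_distrib_mat_vec[OF F])
  then have "F *\<^sub>v X = (F * L) *\<^sub>v (\<Theta> + v)"
    using FLv F assms(2) by (metis carrier_matD(1) mult_mat_vec_carrier right_zero_vec)
  moreover have "L *\<^sub>v (\<Theta> + v) \<noteq> X"
  proof
    assume "L *\<^sub>v (\<Theta> + v) = X"
    then have "X $ i + (L *\<^sub>v v) $ i = X $ i" if "i < J * N" for i
      using sum L that by (metis carrier_matD(1) dim_mult_mat_vec index_add_vec(1))
    then have "L *\<^sub>v v = 0\<^sub>v (J * N)"
      using L by (intro eq_vecI) auto
    then show False using \<open>L *\<^sub>v v \<noteq> 0\<^sub>v (J * N)\<close> by simp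
  qed
  ultimately show "\<exists>\<Theta> \<in> carrier_vec (dim_col (location_matrix P)).
      measurement_matrix J \<Phi> \<omega> *\<^sub>v X = (measurement_matrix J \<Phi> \<omega> * location_matrix P) *\<^sub>v \<Theta> \<and>
      location_matrix P *\<^sub>v \<Theta> \<noteq> X"
    using \<Theta> v L unfolding L_def F_def As_def measurement_matrix_def
    by (intro bexI[of _ "\<Theta> + v"]) auto
qed

end
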